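(* Let $n,d\ge1$, let $H$ be a nonzero $2^n\times2^n$ complex matrix, and let $p_d(H)=a_0I+a_1H+\cdots+a_dH^d$ with $a_k\in\mathbb C$, $a_d\neq0$. Let $W$ be either of the following two $(d+(2d+1)n)$-qubit circuits (notation in the context): (general) $$\mathrm{POLY}_L^\dagger\cdot\big[C_1(P_L^\dagger)\cdots C_d(P_L^\dagger)\big]\cdot\big[\mathrm{SELECT}_d\cdots\mathrm{SELECT}_1\big]\cdot\big[C_d(P_R)\cdots C_1(P_R)\big]\cdot\mathrm{POLY}_R;$$ (simplified; when $P_R=V_RA_R$, $P_L=V_LA_L$ with unitaries on $2n$ qubits such that $V_R|0\rangle_{2n}=V_L|0\rangle_{2n}=|0\rangle_{2n}$ and $A_R,A_L$ consist of $O(1)$ single-qubit gates) $$\mathrm{POLY}_L^\dagger\cdot\big[C_1(A_L^\dagger)\cdots C_d(A_L^\dagger)\big]\cdot\prod_{s=1}^d (V_L^\dagger)_s\cdot\big[\mathrm{SELECT}_d\cdots\mathrm{SELECT}_1\big]\cdot\prod_{s=1}^d (V_R)_s\cdot\big[C_d(A_R)\cdots C_1(A_R)\big]\cdot\mathrm{POLY}_R .$$ Write $W=R_y(-\theta_0)_{1}\cdot W'\cdot R_y(\theta_0)_{1}$, where $R_y(\theta_0)_1$ is the first gate of $\mathrm{POLY}_R$ and $R_y(-\theta_0)_1$ is the last gate of $\mathrm{POLY}_L^\dagger$ (both on the first outer ancilla) and $W'$ is the rest of the circuit. Then controlling the entire circuit is equivalent to controlling only these two rotations: with all ancillas initialized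 in and post-selected on $|0\rangle$, for every control-qubit state $|c\rangle=\alpha|0\rangle+\beta|1\rangle$ and every $n$-qubit state $|\varphi\rangle$, $$\Pi\,\Lambda(W)\,|c\rangle|0\rangle_d|0\rangle_{2dn}|\varphi\rangle=\Pi\,\Lambda\big(R_y(-\theta_0)_1\big)\,(I_1\otimes W')\,\Lambda\big(R_y(\theta_0)_1\big)\,|c\rangle|0\rangle_d|0\rangle_{2dn}|\varphi\rangle,$$ where $\Pi=I_1\otimes\langle0|_d\otimes\langle0|_{2dn}\otimes I_n$.
   Context: $I_m$ is the identity on $m$ qubits, $|0\rangle_m$ the all-zero state of $m$ qubits. $\Lambda(V)=|0\rangle\langle 0|\otimes I+|1\rangle\langle 1|\otimes V$ is controlled-$V$, with an additional (first) control qubit. For $i\in\{0,\dots,2^n-1\}$ with bits $\mathtt i_0,\dots,\mathtt i_{n-1}$, $|i\rangle=|\mathtt i_0\rangle\otimes\cdots\otimes|\mathtt i_{n-1}\rangle$. $X,Z$ are the Pauli matrices. $\arg 0$ is given any fixed value. Write $H=\sum_{i,j=0}^{2^n-1}\alpha_{ij}\bigotimes_{\ell=0}^{n-1}Z^{\mathtt j_\ell}X^{\mathtt i_\ell}$ with $\alpha_{ij}\in\mathbb C$ and $\mathcal N=\sum_{i,j}|\alpha_{ij}|$. $P_R,P_L$ are unitaries on $2n$ qubits with $$P_R|0\rangle_{2n}=\tfrac1{\sqrt{\mathcal N}}\sum_{i,j}e^{\mathrm i\arg\alpha_{ij}}\sqrt{|\alpha_{ij}|}\,|i\rangle|j\rangle,\qquad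 P_L|0\rangle_{2n}=\tfrac1{\sqrt{\mathcal N}}\sum_{i,j}\sqrt{|\alpha_{ij}|}\,|i\rangle|j\rangle .$$ $\mathrm{SELECT}$ acts on three $n$-qubit registers by $\mathrm{SELECT}\,|i\rangle|j\rangle|\varphi\rangle=|i\rangle|j\rangle\otimes\big(\bigotimes_{\ell}Z^{\mathtt j_\ell}X^{\mathtt i_\ell}\big)|\varphi\rangle$. Let $w_k=\sqrt{|a_k|\mathcal N^k}$ ($0\le k\le d$), $\mathcal W=\sum_{k=0}^d w_k^2$, and for $0\le k\le d-1$ let $\phi_k=\arg(a_{k+1})-\arg(a_k)$ and $\theta_k=2\arccos\!\Big(w_k\big/\sqrt{\mathcal W-\sum_{p=0}^{k-1}w_p^2}\Big)$. Let $R_y(\theta)=\begin{pmatrix}\cos\frac\theta2&-\sin\frac\theta2\\ \sin\frac\theta2&\cos\frac\theta2\end{pmatrix}$, $P(\phi)=\mathrm{diag}(1,e^{\mathrm i\phi})$. On $d$ qubits numbered $1,\dots,d$, let $\mathrm{CRY}$ be the ladder applying successively, for $k=1,\dots,d-1$, the gate $R_y(\theta_k)$ on qubit $k+1$ controlled by qubit $k$; and let $\mathrm{P}=P(\phi_0)\otimes P(\phi_1)\otimes\cdots\otimes P(\phi_{d-1})$. With $R_y(\theta_0)_1$ the rotation on qubit $1$, the circuits are $$\mathrm{POLY}_R=\mathrm{P}\cdot\mathrm{CRY}\cdot R_y(\theta_0)_1,\qquad \mathrm{POLY}_L=\mathrm{CRY}\cdot R_y(\theta_0)_1,\qquad \mathrm{POLY}_L^\dagger=R_y(-\theta_0)_1\cdot\mathrm{CRY}^\dagger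 .$$ The qubits of $W$ are: $d$ outer ancillas; $d$ inner ancilla registers of $2n$ qubits each, labelled $s=1,\dots,d$; and an $n$-qubit system register. $\mathrm{POLY}_R$ and $\mathrm{POLY}_L^\dagger$ act on the outer ancillas. $(V)_s$ is $V$ acting on the $s$-th inner register; $C_s(V)$ is $V$ on the $s$-th inner register controlled (on value $1$) by the $s$-th outer ancilla. $\mathrm{SELECT}_s$ is $\mathrm{SELECT}$ acting on the $s$-th inner register and the system register. Operators act from right to left and trivially on unmentioned qubits. "$O(1)$ single-qubit gates" means a number bounded by a constant independent of $n$. *)

theory Defs
  imports "Jordan_Normal_Form.Schur_Decomposition"
begin

section \<open>Tensor products, kets and gate placement\<close>

text \<open>
  Operators on \<open>m\<close> qubits are complex \<open>2^m \<times> 2^m\<close> matrices, states are vectors of dimension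
  \<open>2^m\<close>.  Qubits are numbered from \<open>0\<close>, and qubit \<open>0\<close> is the leftmost tensor factor, hence the
  most significant bit of a basis index.
\<close>

definition tensor_mat :: "complex mat \<Rightarrow> complex mat \<Rightarrow> complex mat" (infixr "\<otimes>\<^sub>m" 72) where
  "A \<otimes>\<^sub>m B = mat (dim_row A * dim_row B) (dim_col A * dim_col B)
     (\<lambda>(r, c). A $$ (r div dim_row B, c div dim_col B) * B $$ (r mod dim_row B, c mod dim_col B))"

definition tensor_vec :: "complex vec \<Rightarrow> complex vec \<Rightarrow> complex vec" (infixr "\<otimes>\<^sub>v" 72) where
  "u \<otimes>\<^sub>v v = vec (dim_vec u * dim_vec v) (\<lambda>r. u $ (r div dim_vec v) * v $ (r mod dim_vec v))"

definition tensor_mats :: "complex mat list \<Rightarrow> complex mat" where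
  "tensor_mats Ms = foldr (\<otimes>\<^sub>m) Ms (1\<^sub>m 1)"

definition tensor_vecs :: "complex vec list \<Rightarrow> complex vec" where
  "tensor_vecs vs = foldr (\<otimes>\<^sub>v) vs (vec 1 (\<lambda>_. 1))"

definition qbit :: "nat \<Rightarrow> nat \<Rightarrow> nat \<Rightarrow> nat" where
  "qbit m x l = x div 2 ^ (m - 1 - l) mod 2"

definition ket :: "nat \<Rightarrow> nat \<Rightarrow> complex vec" where
  "ket m x = tensor_vecs (map (\<lambda>l. unit_vec 2 (qbit m x l)) [0..<m])"

definition bra :: "nat \<Rightarrow> nat \<Rightarrow> complex mat" where
  "bra m x = mat_of_rows (2 ^ m) [conjugate (ket m x)]"

text \<open>Product in written order: the last matrix of the list acts first.\<close>

definition mprod :: "nat \<Rightarrow> complex mat list \<Rightarrow> complex mat" where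
  "mprod m Ms = foldr (*) Ms (1\<^sub>m (2 ^ m))"

definition is_unitary :: "nat \<Rightarrow> complex mat \<Rightarrow> bool" where
  "is_unitary m U \<longleftrightarrow> U \<in> carrier_mat (2 ^ m) (2 ^ m) \<and>
     U * mat_adjoint U = 1\<^sub>m (2 ^ m) \<and> mat_adjoint U * U = 1\<^sub>m (2 ^ m)"

definition is_state :: "nat \<Rightarrow> complex vec \<Rightarrow> bool" where
  "is_state m v \<longleftrightarrow> v \<in> carrier_vec (2 ^ m) \<and> v \<bullet>c v = 1"

definition ctrl :: "complex mat \<Rightarrow> complex mat" where
  "ctrl V = mat_of_rows_list 2 [[1, 0], [0, 0]] \<otimes>\<^sub>m 1\<^sub>m (dim_row V)
          + mat_of_rows_list 2 [[0, 0], [0, 1]] \<otimes>\<^sub>m V"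

text \<open>
  \<open>place N qs V\<close> is the operator on \<open>N\<close> qubits that applies \<open>V\<close> to the distinct qubits listed in
  \<open>qs\<close> (the \<open>k\<close>-th tensor factor of \<open>V\<close> being qubit \<open>qs ! k\<close>) and the identity to all others.
  \<open>subindex N qs x\<close> reads off the bits of \<open>x\<close> at the positions \<open>qs\<close>.
\<close>

definition subindex :: "nat \<Rightarrow> nat list \<Rightarrow> nat \<Rightarrow> nat" where
  "subindex N qs x = foldl (\<lambda>acc q. 2 * acc + qbit N x q) 0 qs"

definition place :: "nat \<Rightarrow> nat list \<Rightarrow> complex mat \<Rightarrow> complex mat" where
  "place N qs V = mat (2 ^ N) (2 ^ N)
     (\<lambda>(r, c). if \<forall>q<N. q \<notin> set qs \<longrightarrow> qbit N r q = qbit N c q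
               then V $$ (subindex N qs r, subindex N qs c) else 0)"

definition single_qubit_circuit :: "nat \<Rightarrow> nat \<Rightarrow> complex mat \<Rightarrow> bool" where
  "single_qubit_circuit K m A \<longleftrightarrow>
     (\<exists>gs. length gs \<le> K \<and> (\<forall>(q, U) \<in> set gs. q < m \<and> is_unitary 1 U) \<and>
           A = mprod m (map (\<lambda>(q, U). place m [q] U) gs))"


section \<open>Block encoding of the matrix\<close>

definition pauli_X :: "complex mat" where
  "pauli_X = mat_of_rows_list 2 [[0, 1], [1, 0]]"

definition pauli_Z :: "complex mat" where
  "pauli_Z = mat_of_rows_list 2 [[1, 0], [0, -1]]"

definition pauli_string :: "nat \<Rightarrow> nat \<Rightarrow> nat \<Rightarrow> complex mat" where
  "pauli_string n i j = tensor_mats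
     (map (\<lambda>l. pauli_Z ^\<^sub>m qbit n j l * pauli_X ^\<^sub>m qbit n i l) [0..<n])"

definition pauli_sum :: "nat \<Rightarrow> (nat \<Rightarrow> nat \<Rightarrow> complex) \<Rightarrow> complex mat" where
  "pauli_sum n \<alpha> = mat (2 ^ n) (2 ^ n)
     (\<lambda>(r, c). \<Sum>i<2 ^ n. \<Sum>j<2 ^ n. \<alpha> i j * pauli_string n i j $$ (r, c))"

definition one_norm :: "nat \<Rightarrow> (nat \<Rightarrow> nat \<Rightarrow> complex) \<Rightarrow> real" where
  "one_norm n \<alpha> = (\<Sum>i<2 ^ n. \<Sum>j<2 ^ n. cmod (\<alpha> i j))"

text \<open>The value of the argument at \<open>0\<close> is an arbitrary convention, hence a parameter.\<close>

definition argument :: "real \<Rightarrow> complex \<Rightarrow> real" where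
  "argument z0 z = (if z = 0 then z0 else Arg z)"

definition pair_state :: "nat \<Rightarrow> (nat \<Rightarrow> nat \<Rightarrow> complex) \<Rightarrow> complex vec" where
  "pair_state n f = vec (2 ^ (2 * n))
     (\<lambda>x. \<Sum>i<2 ^ n. \<Sum>j<2 ^ n. f i j * (ket n i \<otimes>\<^sub>v ket n j) $ x)"

definition prep_R :: "real \<Rightarrow> nat \<Rightarrow> (nat \<Rightarrow> nat \<Rightarrow> complex) \<Rightarrow> complex vec" where
  "prep_R z0 n \<alpha> = complex_of_real (1 / sqrt (one_norm n \<alpha>)) \<cdot>\<^sub>v
     pair_state n (\<lambda>i j. cis (argument z0 (\<alpha> i j)) * complex_of_real (sqrt (cmod (\<alpha> i j))))"

definition prep_L :: "nat \<Rightarrow> (nat \<Rightarrow> nat \<Rightarrow> complex) \<Rightarrow> complex vec" where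
  "prep_L n \<alpha> = complex_of_real (1 / sqrt (one_norm n \<alpha>)) \<cdot>\<^sub>v
     pair_state n (\<lambda>i j. complex_of_real (sqrt (cmod (\<alpha> i j))))"

text \<open>
  Block diagonal with the Pauli string of \<open>(i, j)\<close> as the block at \<open>|i\<rangle>|j\<rangle>\<close>; the action on
  \<open>|i\<rangle>|j\<rangle>|\<phi>\<rangle>\<close> is lemma \<open>SELECT_action\<close> below.
\<close>

definition SELECT :: "nat \<Rightarrow> complex mat" where
  "SELECT n = mat (2 ^ (3 * n)) (2 ^ (3 * n))
     (\<lambda>(r, c). if r div 2 ^ n = c div 2 ^ n
               then pauli_string n (c div 2 ^ n div 2 ^ n) (c div 2 ^ n mod 2 ^ n)
                      $$ (r mod 2 ^ n, c mod 2 ^ n)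
               else 0)"


section \<open>Coefficient circuits on the outer ancillas\<close>

definition weight :: "(nat \<Rightarrow> complex) \<Rightarrow> real \<Rightarrow> nat \<Rightarrow> real" where
  "weight a N k = sqrt (cmod (a k) * N ^ k)"

definition total_weight :: "(nat \<Rightarrow> complex) \<Rightarrow> real \<Rightarrow> nat \<Rightarrow> real" where
  "total_weight a N d = (\<Sum>k\<le>d. (weight a N k)\<^sup>2)"

definition theta :: "(nat \<Rightarrow> complex) \<Rightarrow> real \<Rightarrow> nat \<Rightarrow> nat \<Rightarrow> real" where
  "theta a N d k =
     2 * arccos (weight a N k / sqrt (total_weight a N d - (\<Sum>p<k. (weight a N p)\<^sup>2)))"

definition phase :: "real \<Rightarrow> (nat \<Rightarrow> complex) \<Rightarrow> nat \<Rightarrow> real" where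
  "phase z0 a k = argument z0 (a (Suc k)) - argument z0 (a k)"

definition Ry :: "real \<Rightarrow> complex mat" where
  "Ry t = mat_of_rows_list 2 (map (map complex_of_real)
     [[cos (t / 2), - sin (t / 2)], [sin (t / 2), cos (t / 2)]])"

definition phase_gate :: "real \<Rightarrow> complex mat" where
  "phase_gate t = mat_of_rows_list 2 [[1, 0], [0, cis t]]"

text \<open>
  The \<open>k\<close>-th outer ancilla, counted from \<open>1\<close>, is qubit \<open>k - 1\<close>.
\<close>

definition CRY :: "(nat \<Rightarrow> complex) \<Rightarrow> real \<Rightarrow> nat \<Rightarrow> complex mat" where
  "CRY a N d = mprod d (rev (map (\<lambda>k. place d [k - 1, k] (ctrl (Ry (theta a N d k)))) [1..<d]))"

definition phase_layer :: "real \<Rightarrow> (nat \<Rightarrow> complex) \<Rightarrow> nat \<Rightarrow> complex mat" where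
  "phase_layer z0 a d = tensor_mats (map (\<lambda>k. phase_gate (phase z0 a k)) [0..<d])"

definition POLY_L :: "(nat \<Rightarrow> complex) \<Rightarrow> real \<Rightarrow> nat \<Rightarrow> complex mat" where
  "POLY_L a N d = CRY a N d * place d [0] (Ry (theta a N d 0))"

definition POLY_R :: "real \<Rightarrow> (nat \<Rightarrow> complex) \<Rightarrow> real \<Rightarrow> nat \<Rightarrow> complex mat" where
  "POLY_R z0 a N d = phase_layer z0 a d * CRY a N d * place d [0] (Ry (theta a N d 0))"


section \<open>The circuits\<close>

text \<open>
  Qubit layout: the \<open>d\<close> outer ancillas, then the inner registers \<open>1, \<dots>, d\<close> of \<open>2 n\<close> qubits each,
  then the \<open>n\<close> system qubits.
\<close>

definition qubits :: "nat \<Rightarrow> nat \<Rightarrow> nat" where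
  "qubits n d = d + (2 * d + 1) * n"

definition inner_reg :: "nat \<Rightarrow> nat \<Rightarrow> nat \<Rightarrow> nat list" where
  "inner_reg n d s = [d + 2 * n * (s - 1)..<d + 2 * n * s]"

definition system_reg :: "nat \<Rightarrow> nat \<Rightarrow> nat list" where
  "system_reg n d = [d + 2 * n * d..<qubits n d]"

definition on_outer :: "nat \<Rightarrow> nat \<Rightarrow> complex mat \<Rightarrow> complex mat" where
  "on_outer n d V = place (qubits n d) [0..<d] V"

definition on_inner :: "nat \<Rightarrow> nat \<Rightarrow> nat \<Rightarrow> complex mat \<Rightarrow> complex mat" where
  "on_inner n d s V = place (qubits n d) (inner_reg n d s) V"

definition ctrl_inner :: "nat \<Rightarrow> nat \<Rightarrow> nat \<Rightarrow> complex mat \<Rightarrow> complex mat" where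
  "ctrl_inner n d s V = place (qubits n d) ((s - 1) # inner_reg n d s) (ctrl V)"

definition select_at :: "nat \<Rightarrow> nat \<Rightarrow> nat \<Rightarrow> complex mat" where
  "select_at n d s = place (qubits n d) (inner_reg n d s @ system_reg n d) (SELECT n)"

text \<open>
  The part of the circuit strictly between the two coefficient circuits, for both variants.
\<close>

definition general_core :: "nat \<Rightarrow> nat \<Rightarrow> complex mat \<Rightarrow> complex mat \<Rightarrow> complex mat" where
  "general_core n d PR PL =
     mprod (qubits n d) (map (\<lambda>s. ctrl_inner n d s (mat_adjoint PL)) [1..<Suc d])
   * mprod (qubits n d) (rev (map (select_at n d) [1..<Suc d]))
   * mprod (qubits n d) (rev (map (\<lambda>s. ctrl_inner n d s PR) [1..<Suc d]))"

definition simplified_core ::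
  "nat \<Rightarrow> nat \<Rightarrow> complex mat \<Rightarrow> complex mat \<Rightarrow> complex mat \<Rightarrow> complex mat \<Rightarrow> complex mat" where
  "simplified_core n d VR AR VL AL =
     mprod (qubits n d) (map (\<lambda>s. ctrl_inner n d s (mat_adjoint AL)) [1..<Suc d])
   * mprod (qubits n d) (map (\<lambda>s. on_inner n d s (mat_adjoint VL)) [1..<Suc d])
   * mprod (qubits n d) (rev (map (select_at n d) [1..<Suc d]))
   * mprod (qubits n d) (map (\<lambda>s. on_inner n d s VR) [1..<Suc d])
   * mprod (qubits n d) (rev (map (\<lambda>s. ctrl_inner n d s AR) [1..<Suc d]))"

definition circuit_W ::
  "real \<Rightarrow> nat \<Rightarrow> (nat \<Rightarrow> complex) \<Rightarrow> real \<Rightarrow> nat \<Rightarrow> complex mat \<Rightarrow> complex mat" where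
  "circuit_W z0 n a N d core =
     on_outer n d (mat_adjoint (POLY_L a N d)) * core * on_outer n d (POLY_R z0 a N d)"

text \<open>
  What is left of \<open>circuit_W\<close> once \<open>R\<^sub>y(\<theta>\<^sub>0)\<close> and \<open>R\<^sub>y(-\<theta>\<^sub>0)\<close> on the first outer ancilla are removed.
\<close>

definition circuit_W' ::
  "real \<Rightarrow> nat \<Rightarrow> (nat \<Rightarrow> complex) \<Rightarrow> real \<Rightarrow> nat \<Rightarrow> complex mat \<Rightarrow> complex mat" where
  "circuit_W' z0 n a N d core =
     on_outer n d (mat_adjoint (CRY a N d)) * core * on_outer n d (phase_layer z0 a d * CRY a N d)"

definition postselect :: "nat \<Rightarrow> nat \<Rightarrow> complex mat" where
  "postselect n d = 1\<^sub>m 2 \<otimes>\<^sub>m bra d 0 \<otimes>\<^sub>m bra (2 * d * n) 0 \<otimes>\<^sub>m 1\<^sub>m (2 ^ n)"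


section \<open>Consistency of the encodings\<close>

lemma ket_mod: "ket m x = unit_vec (2 ^ m) (x mod 2 ^ m)"
proof (induction m)
  case 0
  show ?case by (auto simp: ket_def tensor_vecs_def unit_vec_def intro!: eq_vecI)
next
  case (Suc m)
  have tl: "map (\<lambda>l. unit_vec 2 (qbit (Suc m) x l)) [0..<Suc m]
      = unit_vec 2 (x div 2 ^ m mod 2) # map (\<lambda>l. unit_vec 2 (qbit m x l)) [0..<m]"
    by (auto simp: upt_conv_Cons map_Suc_upt [symmetric] qbit_def simp del: upt_Suc)
  have "ket (Suc m) x = unit_vec 2 (x div 2 ^ m mod 2) \<otimes>\<^sub>v ket m x"
    unfolding ket_def tl by (simp add: tensor_vecs_def)
  also have "\<dots> = unit_vec (2 ^ Suc m) (x mod 2 ^ Suc m)"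
  proof (rule eq_vecI)
    fix r :: nat assume "r < dim_vec (unit_vec (2 ^ Suc m) (x mod 2 ^ Suc m) :: complex vec)"
    then have r: "r < 2 * 2 ^ m" by simp
    have m2: "x mod 2 ^ Suc m = (x div 2 ^ m mod 2) * 2 ^ m + x mod 2 ^ m"
      using mod_mult2_eq [of x "2 ^ m" 2] by (simp add: mult.commute)
    have "r div 2 ^ m = x div 2 ^ m mod 2 \<and> r mod 2 ^ m = x mod 2 ^ m \<longleftrightarrow> r = x mod 2 ^ Suc m"
      unfolding m2 by (metis div_mult_mod_eq add.commute div_mult_self1 mod_mult_self1
        mod_div_trivial mod_mod_trivial add_0 power_not_zero zero_neq_numeral)
    moreover have "r div 2 ^ m < 2" using r by (simp add: less_mult_imp_div_less)
    ultimately show "(unit_vec 2 (x div 2 ^ m mod 2) \<otimes>\<^sub>v ket m x) $ r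
        = unit_vec (2 ^ Suc m) (x mod 2 ^ Suc m) $ r"
      using r by (auto simp: tensor_vec_def Suc.IH unit_vec_def)
  qed (simp add: tensor_vec_def Suc.IH)
  finally show ?case .
qed

lemma ket_eq_unit_vec: "x < 2 ^ m \<Longrightarrow> ket m x = unit_vec (2 ^ m) x"
  by (simp add: ket_mod)

lemma tensor_mat_carrier:
  "A \<in> carrier_mat p q \<Longrightarrow> B \<in> carrier_mat r s \<Longrightarrow> A \<otimes>\<^sub>m B \<in> carrier_mat (p * r) (q * s)"
  by (auto simp: tensor_mat_def)

lemma pauli_string_carrier: "pauli_string n i j \<in> carrier_mat (2 ^ n) (2 ^ n)"
proof -
  have Z: "pauli_Z \<in> carrier_mat 2 2" and X: "pauli_X \<in> carrier_mat 2 2"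
    by (auto simp: pauli_Z_def pauli_X_def mat_of_rows_list_def)
  have g: "pauli_Z ^\<^sub>m p * pauli_X ^\<^sub>m q \<in> carrier_mat 2 2" for p q
    using pow_carrier_mat [OF Z] pow_carrier_mat [OF X] by (rule mult_carrier_mat)
  have "tensor_mats (map (\<lambda>l. pauli_Z ^\<^sub>m f l * pauli_X ^\<^sub>m h l) ls)
      \<in> carrier_mat (2 ^ length ls) (2 ^ length ls)" for f h and ls :: "nat list"
  proof (induction ls)
    case Nil
    show ?case by (simp add: tensor_mats_def)
  next
    case (Cons l ls)
    from tensor_mat_carrier [OF g [of "f l" "h l"] Cons.IH] show ?case
      by (simp add: tensor_mats_def)
  qed
  from this [of "qbit n j" "qbit n i" "[0..<n]"] show ?thesis
    by (simp add: pauli_string_def)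
qed

lemma SELECT_action:
  assumes i: "i < 2 ^ n" and j: "j < 2 ^ n" and phi: "\<phi> \<in> carrier_vec (2 ^ n)"
  shows "SELECT n *\<^sub>v (ket n i \<otimes>\<^sub>v ket n j \<otimes>\<^sub>v \<phi>)
       = ket n i \<otimes>\<^sub>v ket n j \<otimes>\<^sub>v (pauli_string n i j *\<^sub>v \<phi>)"
proof -
  define B where "B = (2::nat) ^ n"
  have B0: "B > 0" by (simp add: B_def)
  have B3: "2 ^ (3 * n) = B * B * B"
    by (simp add: B_def power_mult power3_eq_cube mult.commute [of 3])
  have dphi: "dim_vec \<phi> = B" using phi by (simp add: B_def)
  have P: "pauli_string n i j \<in> carrier_mat B B"
    using pauli_string_carrier by (simp add: B_def)
  have idx: "(ket n i \<otimes>\<^sub>v ket n j \<otimes>\<^sub>v v) $ r = (if r div B = i * B + j then v $ (r mod B) else 0)"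
    if v: "dim_vec v = B" and r: "r < B * B * B" for v r
  proof -
    have d: "r div (B * B) = r div B div B" by (simp add: div_mult2_eq)
    have rB: "r div B < B * B" using r by (simp add: less_mult_imp_div_less)
    have l1: "r div B div B < B" using rB by (simp add: less_mult_imp_div_less)
    have m: "r mod (B * B) = B * (r div B mod B) + r mod B" by (simp add: mod_mult2_eq)
    have m1: "r mod (B * B) div B = r div B mod B" using B0 unfolding m by simp
    have m2: "r mod (B * B) mod B = r mod B" unfolding m by simp
    have l2: "r mod (B * B) < B * B" using B0 by simp
    have jB: "j < B" using j by (simp add: B_def)
    have e: "r div B = i * B + j \<longleftrightarrow> r div B div B = i \<and> r div B mod B = j"
    proof
      assume "r div B = i * B + j" then show "r div B div B = i \<and> r div B mod B = j"
        using jB B0 by simp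
    next
      assume "r div B div B = i \<and> r div B mod B = j" then show "r div B = i * B + j"
        using div_mult_mod_eq [of "r div B" B] by simp
    qed
    have rr: "r < B * (B * B)" using r by (simp add: mult.assoc)
    have k: "dim_vec (ket n i) = B" "dim_vec (ket n j) = B"
      "ket n i = unit_vec B i" "ket n j = unit_vec B j"
      using i j by (simp_all add: ket_eq_unit_vec B_def)
    have "(ket n i \<otimes>\<^sub>v ket n j \<otimes>\<^sub>v v) $ r
        = unit_vec B i $ (r div (B * B)) *
          (unit_vec B j $ (r mod (B * B) div B) * v $ (r mod (B * B) mod B))"
      using rr l2 v by (simp add: tensor_vec_def k)
    also have "\<dots> = (if r div B div B = i then 1 else 0) *
        ((if r div B mod B = j then 1 else 0) * v $ (r mod B))"
      using l1 B0 unfolding d m1 m2 by (simp add: unit_vec_def)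
    also have "\<dots> = (if r div B = i * B + j then v $ (r mod B) else 0)"
      unfolding e by simp
    finally show ?thesis .
  qed
  have dk: "dim_vec (ket n x) = B" for x by (simp add: ket_mod B_def)
  have ij: "i * B + j < B * B"
  proof -
    have "i * B + j < i * B + B" using j by (simp add: B_def)
    also have "\<dots> = (i + 1) * B" by simp
    also have "\<dots> \<le> B * B" using i unfolding B_def by (intro mult_right_mono) auto
    finally show ?thesis .
  qed
  show ?thesis
  proof (rule eq_vecI)
    fix r assume "r < dim_vec (ket n i \<otimes>\<^sub>v ket n j \<otimes>\<^sub>v (pauli_string n i j *\<^sub>v \<phi>))"
    then have r: "r < B * B * B" using P by (simp add: tensor_vec_def dk mult.assoc)
    let ?f = "\<lambda>c. if r div B = i * B + j \<and> c div B = i * B + j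
      then pauli_string n i j $$ (r mod B, c mod B) * \<phi> $ (c mod B) else 0"
    have jB: "j < B" using j by (simp add: B_def)
    have "(SELECT n *\<^sub>v (ket n i \<otimes>\<^sub>v ket n j \<otimes>\<^sub>v \<phi>)) $ r
        = (\<Sum>c<B * B * B. SELECT n $$ (r, c) * (ket n i \<otimes>\<^sub>v ket n j \<otimes>\<^sub>v \<phi>) $ c)"
      using r dphi unfolding SELECT_def B3
      by (auto simp: scalar_prod_def tensor_vec_def dk mult.assoc atLeast0LessThan intro!: sum.cong)
    also have "\<dots> = (\<Sum>c<B * B * B. ?f c)"
    proof (rule sum.cong [OF refl])
      fix c assume "c \<in> {..<B * B * B}"
      then have c: "c < B * B * B" by simp
      have "SELECT n $$ (r, c) = (if r div B = c div B
          then pauli_string n (c div B div B) (c div B mod B) $$ (r mod B, c mod B) else 0)"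
        using r c by (simp add: SELECT_def B3 B_def [symmetric])
      then show "SELECT n $$ (r, c) * (ket n i \<otimes>\<^sub>v ket n j \<otimes>\<^sub>v \<phi>) $ c = ?f c"
        using jB B0 unfolding idx [OF dphi c] by auto
    qed
    also have "\<dots> = (if r div B = i * B + j
        then \<Sum>k<B. pauli_string n i j $$ (r mod B, k) * \<phi> $ k else 0)"
    proof (cases "r div B = i * B + j")
      case True
      have "(\<Sum>c<B * B * B. ?f c)
          = (\<Sum>c \<in> (\<lambda>k. (i * B + j) * B + k) ` {..<B}. ?f c)"
      proof (rule sum.mono_neutral_right)
        show "(\<lambda>k. (i * B + j) * B + k) ` {..<B} \<subseteq> {..<B * B * B}"
        proof clarsimp
          fix k assume "k < B"
          then have "(i * B + j) * B + k < (i * B + j + 1) * B" by simp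
          also have "\<dots> \<le> B * B * B" using ij by (intro mult_right_mono) auto
          finally show "(i * B + j) * B + k < B * B * B" .
        qed
        show "\<forall>c \<in> {..<B * B * B} - (\<lambda>k. (i * B + j) * B + k) ` {..<B}. ?f c = 0"
        proof
          fix c assume c: "c \<in> {..<B * B * B} - (\<lambda>k. (i * B + j) * B + k) ` {..<B}"
          have "c div B \<noteq> i * B + j"
          proof
            assume "c div B = i * B + j"
            then have "c = (i * B + j) * B + c mod B" using div_mult_mod_eq [of c B] by simp
            moreover have "c mod B < B" using B0 by simp
            ultimately show False using c by blast
          qed
          then show "?f c = 0" by simp
        qed
      qed simp
      also have "\<dots> = (\<Sum>k<B. ?f ((i * B + j) * B + k))"
        by (subst sum.reindex) (auto simp: inj_on_def)
      also have "\<dots> = (\<Sum>k<B. pauli_string n i j $$ (r mod B, k) * \<phi> $ k)"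
        using True by (intro sum.cong) auto
      finally show ?thesis using True by simp
    qed simp
    also have "\<dots> = (ket n i \<otimes>\<^sub>v ket n j \<otimes>\<^sub>v (pauli_string n i j *\<^sub>v \<phi>)) $ r"
      using P dphi B0 r by (subst idx) (auto simp: scalar_prod_def atLeast0LessThan)
    finally show "(SELECT n *\<^sub>v (ket n i \<otimes>\<^sub>v ket n j \<otimes>\<^sub>v \<phi>)) $ r
        = (ket n i \<otimes>\<^sub>v ket n j \<otimes>\<^sub>v (pauli_string n i j *\<^sub>v \<phi>)) $ r" .
  qed (use P dphi in \<open>simp add: SELECT_def B3 tensor_vec_def dk\<close>)
qed

end

theory Submission
  imports Defs
begin

text \<open>
  On the branch with control \<open>|1\<rangle>\<close> both sides apply \<open>W\<close>.  On the branch with control \<open>|0\<rangle>\<close> the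
  left side does nothing and the right side applies \<open>W'\<close>; but every gate of \<open>W'\<close> fixes the initial
  state, since without the rotation \<open>R\<^sub>y(\<theta>\<^sub>0)\<close> no outer ancilla ever leaves \<open>|0\<rangle>\<close>, so no controlled gate
  fires, and \<open>SELECT\<close> on \<open>|0\<rangle>|0\<rangle>\<close> is the empty Pauli string.  The two sides therefore agree even before
  post-selection.

  With ancillas leftmost, the states \<open>|0\<dots>0\<rangle>|\<phi>\<rangle>\<close> are those supported on the first \<open>2^n\<close> basis states.
  Gates are tracked through the condition that their rows and columns with such an index agree with
  those of the identity; demanding it of rows as well makes it stable under adjoints.
\<close>

section \<open>Adjoints and tensor products\<close>

lemma index_mat_adjoint [simp]:
  "i < dim_col A \<Longrightarrow> j < dim_row A \<Longrightarrow> mat_adjoint A $$ (i, j) = conjugate (A $$ (j, i))"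
  "dim_row (mat_adjoint A) = dim_col A"
  "dim_col (mat_adjoint A) = dim_row A"
  by (simp_all add: mat_adjoint_def mat_of_rows_def)

lemma mat_adjoint_carrier: "A \<in> carrier_mat m n \<Longrightarrow> mat_adjoint A \<in> carrier_mat n m"
  by (intro carrier_matI) auto

lemma mat_adjoint_mult:
  assumes "A \<in> carrier_mat l m" "B \<in> carrier_mat m n"
  shows "mat_adjoint (A * B) = mat_adjoint B * mat_adjoint (A :: complex mat)"
  using assms by (intro eq_matI) (auto simp: scalar_prod_def mult.commute)

lemma mat_adjoint_tensor_mat: "mat_adjoint (A \<otimes>\<^sub>m B) = mat_adjoint A \<otimes>\<^sub>m mat_adjoint B"
proof (rule eq_matI)
  fix i j assume "i < dim_row (mat_adjoint A \<otimes>\<^sub>m mat_adjoint B)"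
    "j < dim_col (mat_adjoint A \<otimes>\<^sub>m mat_adjoint B)"
  then have i: "i < dim_col A * dim_col B" and j: "j < dim_row A * dim_row B"
    by (simp_all add: tensor_mat_def)
  then have "0 < dim_col B" "0 < dim_row B" by (auto intro: Nat.gr0I)
  then have "i mod dim_col B < dim_col B" "j mod dim_row B < dim_row B" by simp_all
  then show "mat_adjoint (A \<otimes>\<^sub>m B) $$ (i, j) = (mat_adjoint A \<otimes>\<^sub>m mat_adjoint B) $$ (i, j)"
    using i j by (simp add: tensor_mat_def less_mult_imp_div_less)
qed (simp_all add: tensor_mat_def)

lemma mat_adjoint_one [simp]: "mat_adjoint (1\<^sub>m n) = (1\<^sub>m n :: complex mat)"
  by (rule eq_matI) auto

text \<open>The mixed-product rule for an identity right factor, the form that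
  \<open>place_prefix\<close> gives to operators on leading qubits. The identity ties the
  intermediate index to the residue of \<open>i\<close> modulo \<open>k\<close>, so the sum over
  \<open>m * k\<close> indices collapses to one over the \<open>m\<close> quotients.\<close>

lemma tensor_mat_mult_one:
  assumes A: "A \<in> carrier_mat l m" and B: "B \<in> carrier_mat m n"
  shows "(A \<otimes>\<^sub>m 1\<^sub>m k) * (B \<otimes>\<^sub>m 1\<^sub>m k) = (A * B) \<otimes>\<^sub>m 1\<^sub>m k"
proof (rule eq_matI)
  fix i j assume "i < dim_row ((A * B) \<otimes>\<^sub>m 1\<^sub>m k)" "j < dim_col ((A * B) \<otimes>\<^sub>m 1\<^sub>m k)"
  then have i: "i < l * k" and j: "j < n * k" using A B by (simp_all add: tensor_mat_def)
  then have k: "k > 0" by (cases k) auto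
  have ij: "i div k < l" "i mod k < k" "j div k < n" "j mod k < k"
    using i j k by (simp_all add: less_mult_imp_div_less)
  have "((A \<otimes>\<^sub>m 1\<^sub>m k) * (B \<otimes>\<^sub>m 1\<^sub>m k)) $$ (i, j)
      = (\<Sum>x<m * k. (A $$ (i div k, x div k) * of_bool (i mod k = x mod k)) *
                     (B $$ (x div k, j div k) * of_bool (x mod k = j mod k)))"
    using A B i j k by (simp add: tensor_mat_def scalar_prod_def atLeast0LessThan of_bool_def)
  also have "\<dots> = (\<Sum>x \<in> (\<lambda>y. y * k + i mod k) ` {..<m}.
      (A $$ (i div k, x div k) * of_bool (i mod k = x mod k)) *
      (B $$ (x div k, j div k) * of_bool (x mod k = j mod k)))"
  proof (rule sum.mono_neutral_right)
    show "(\<lambda>y. y * k + i mod k) ` {..<m} \<subseteq> {..<m * k}"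
    proof clarsimp
      fix y assume "y < m"
      have "y * k + i mod k < (y + 1) * k" using k by simp
      also have "\<dots> \<le> m * k" using \<open>y < m\<close> by (intro mult_right_mono) auto
      finally show "y * k + i mod k < m * k" .
    qed
    show "\<forall>x\<in>{..<m * k} - (\<lambda>y. y * k + i mod k) ` {..<m}.
      (A $$ (i div k, x div k) * of_bool (i mod k = x mod k)) *
      (B $$ (x div k, j div k) * of_bool (x mod k = j mod k)) = 0"
    proof
      fix x assume x: "x \<in> {..<m * k} - (\<lambda>y. y * k + i mod k) ` {..<m}"
      have "i mod k \<noteq> x mod k"
      proof
        assume "i mod k = x mod k"
        then have "x = (x div k) * k + i mod k" by (metis div_mult_mod_eq)
        moreover have "x div k < m" using x by (simp add: less_mult_imp_div_less)
        ultimately show False using x by blast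
      qed
      then show "(A $$ (i div k, x div k) * of_bool (i mod k = x mod k)) *
        (B $$ (x div k, j div k) * of_bool (x mod k = j mod k)) = 0" by simp
    qed
  qed simp
  also have "\<dots> = (\<Sum>y<m. A $$ (i div k, y) * (B $$ (y, j div k) * of_bool (i mod k = j mod k)))"
    using k by (subst sum.reindex) (auto simp: inj_on_def intro!: sum.cong)
  also have "\<dots> = ((A * B) \<otimes>\<^sub>m 1\<^sub>m k) $$ (i, j)"
    using A B i j ij by (auto simp: tensor_mat_def scalar_prod_def atLeast0LessThan)
  finally show "((A \<otimes>\<^sub>m 1\<^sub>m k) * (B \<otimes>\<^sub>m 1\<^sub>m k)) $$ (i, j) = ((A * B) \<otimes>\<^sub>m 1\<^sub>m k) $$ (i, j)" .
qed (use A B in \<open>simp_all add: tensor_mat_def\<close>)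

text \<open>Dividing by \<open>k * l\<close> amounts to dividing by \<open>l\<close> and then by
  \<open>k\<close>, for quotients as well as remainders. This merges the two paddings in
  \<open>on_outer_first\<close>.\<close>

lemma tensor_mat_one_one: "(A \<otimes>\<^sub>m 1\<^sub>m k) \<otimes>\<^sub>m 1\<^sub>m l = A \<otimes>\<^sub>m 1\<^sub>m (k * l)"
proof (rule eq_matI)
  fix i j assume i: "i < dim_row (A \<otimes>\<^sub>m 1\<^sub>m (k * l))" and j: "j < dim_col (A \<otimes>\<^sub>m 1\<^sub>m (k * l))"
  then have kl: "k > 0" "l > 0" by (auto simp: tensor_mat_def intro: Nat.gr0I)
  have ij: "i < dim_row A * k * l" "j < dim_col A * k * l"
    using i j by (simp_all add: tensor_mat_def mult.assoc)
  then have "i div l < dim_row A * k" "j div l < dim_col A * k"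
    by (simp_all only: less_mult_imp_div_less)
  moreover have "i mod (k * l) = j mod (k * l)
      \<longleftrightarrow> i div l mod k = j div l mod k \<and> i mod l = j mod l"
  proof -
    have "x mod (k * l) mod l = x mod l" "x mod (k * l) div l = x div l mod k"
      "x mod (k * l) = l * (x div l mod k) + x mod l" for x :: nat
      using kl by (simp_all add: mult.commute [of k l] mod_mult2_eq)
    then show ?thesis by metis
  qed
  ultimately show "((A \<otimes>\<^sub>m 1\<^sub>m k) \<otimes>\<^sub>m 1\<^sub>m l) $$ (i, j) = (A \<otimes>\<^sub>m 1\<^sub>m (k * l)) $$ (i, j)"
    using ij kl by (simp add: tensor_mat_def mult.assoc [symmetric])
      (simp add: mult.commute [of k l] div_mult2_eq)
qed (simp_all add: tensor_mat_def)

lemma tensor_mat_one [simp]: "1\<^sub>m k \<otimes>\<^sub>m 1\<^sub>m l = 1\<^sub>m (k * l)"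
proof (rule eq_matI)
  fix i j assume "i < dim_row (1\<^sub>m (k * l) :: complex mat)" "j < dim_col (1\<^sub>m (k * l) :: complex mat)"
  then have i: "i < k * l" and j: "j < k * l" by simp_all
  then have "l > 0" by (auto intro: Nat.gr0I)
  moreover have "i div l = j div l \<and> i mod l = j mod l \<longleftrightarrow> i = j"
    by (metis div_mult_mod_eq)
  ultimately show "(1\<^sub>m k \<otimes>\<^sub>m 1\<^sub>m l) $$ (i, j) = 1\<^sub>m (k * l) $$ (i, j)"
    using i j by (auto simp: tensor_mat_def less_mult_imp_div_less)
qed (simp_all add: tensor_mat_def)


section \<open>Gate placement\<close>

text \<open>Opens the way to bitwise extensionality and \<open>take_bit\<close>. Qubit
  \<open>0\<close> is the most significant bit, hence the reversal of positions.\<close>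

lemma qbit_conv_bit: "qbit N x q = of_bool (bit x (N - 1 - q))"
  by (simp add: qbit_def bit_iff_odd mod_2_eq_odd)

lemma subindex_Nil [simp]: "subindex N [] x = 0"
  by (simp add: subindex_def)

lemma subindex_snoc [simp]: "subindex N (qs @ [q]) x = 2 * subindex N qs x + qbit N x q"
  by (simp add: subindex_def)

lemma subindex_less: "subindex N qs x < 2 ^ length qs"
  by (induction qs rule: rev_induct) (auto simp: qbit_conv_bit)

text \<open>Reading one more qubit turns \<open>s\<close> into \<open>2 * s + b\<close> with
  \<open>b < 2\<close>, so parity recovers \<open>b\<close> and halving recovers
  \<open>s\<close>.\<close>

lemma subindex_eq_iff:
  "subindex N qs x = subindex N qs y \<longleftrightarrow> (\<forall>q\<in>set qs. qbit N x q = qbit N y q)"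
proof (induction qs rule: rev_induct)
  case (snoc q qs)
  have "2 * s + qbit N x q = 2 * t + qbit N y q \<longleftrightarrow> s = t \<and> qbit N x q = qbit N y q" for s t
  proof -
    have "qbit N x q < 2" "qbit N y q < 2" by (simp_all add: qbit_def)
    then show ?thesis by presburger
  qed
  with snoc show ?case by auto
qed simp

lemma subindex_zero [simp]: "subindex N qs 0 = 0"
  by (induction qs rule: rev_induct) (simp_all add: qbit_def)

lemma subindex_eq_0_iff: "subindex N qs x = 0 \<longleftrightarrow> (\<forall>q\<in>set qs. qbit N x q = 0)"
  using subindex_eq_iff [of N qs x 0] by (simp add: qbit_def)

lemma subindex_append:
  "subindex N (ps @ qs) x = subindex N ps x * 2 ^ length qs + subindex N qs x"
proof (induction qs rule: rev_induct)
  case (snoc q qs)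
  then show ?case by (simp add: append_assoc [symmetric] del: append_assoc)
qed simp

text \<open>Bit \<open>k < N\<close> is qubit \<open>N - 1 - k\<close>; the bits from
  \<open>N\<close> on vanish on both sides by the size bounds.\<close>

lemma qbit_eqI:
  assumes "x < 2 ^ N" "y < 2 ^ N" "\<And>q. q < N \<Longrightarrow> qbit N x q = qbit N y q"
  shows "x = y"
proof (rule bit_eqI)
  fix k
  show "bit x k \<longleftrightarrow> bit y k"
  proof (cases "k < N")
    case True
    then show ?thesis using assms(3) [of "N - 1 - k"]
      by (simp add: qbit_conv_bit of_bool_eq_iff del: of_bool_eq_0_iff)
  next
    case False
    then have "\<not> bit z k" if "z < 2 ^ N" for z :: nat
      using that by (metis bit_take_bit_iff take_bit_nat_eq_self)
    with assms(1,2) show ?thesis by blast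
  qed
qed

lemma place_carrier [simp]: "place N qs V \<in> carrier_mat (2 ^ N) (2 ^ N)"
  by (simp add: place_def)

lemma subindex_prefix:
  assumes "d \<le> N" "x < 2 ^ N"
  shows "subindex N [0..<d] x = x div 2 ^ (N - d)"
  using assms(1)
proof (induction d)
  case (Suc d)
  then have "(2::nat) ^ (N - d) = 2 ^ (N - Suc d) * 2"
    by (metis Suc_diff_Suc Suc_le_lessD power_Suc2)
  with Suc show ?case by (simp add: qbit_def div_mult2_eq)
qed (use assms in simp)

text \<open>The untouched qubits are the \<open>N - d\<close> low bits, so agreeing on them means
  having equal remainders modulo \<open>2 ^ (N - d)\<close>, which is the identity factor. The
  touched ones are the quotient, by \<open>subindex_prefix\<close>.\<close>

lemma place_prefix:
  assumes "d \<le> N" "V \<in> carrier_mat (2 ^ d) (2 ^ d)"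
  shows "place N [0..<d] V = V \<otimes>\<^sub>m 1\<^sub>m (2 ^ (N - d))"
proof (rule eq_matI)
  have D: "(2::nat) ^ d * 2 ^ (N - d) = 2 ^ N" using assms by (simp flip: power_add)
  fix r c assume "r < dim_row (V \<otimes>\<^sub>m 1\<^sub>m (2 ^ (N - d)))" "c < dim_col (V \<otimes>\<^sub>m 1\<^sub>m (2 ^ (N - d)))"
  then have rc: "r < 2 ^ N" "c < 2 ^ N" using assms D by (simp_all add: tensor_mat_def)
  have "(\<forall>q<N. q \<notin> set [0..<d] \<longrightarrow> qbit N r q = qbit N c q)
      \<longleftrightarrow> take_bit (N - d) r = take_bit (N - d) c"
  proof
    assume *: "\<forall>q<N. q \<notin> set [0..<d] \<longrightarrow> qbit N r q = qbit N c q"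
    show "take_bit (N - d) r = take_bit (N - d) c"
    proof (rule bit_eqI)
      fix k
      have "bit r k = bit c k" if "k < N - d"
      proof -
        \<comment> \<open>The qubit holding bit \<open>k\<close>; reversing the position twice
          returns \<open>k\<close>, and \<open>k < N - d\<close> puts it outside the prefix.\<close>
        from that have "N - 1 - k < N" "N - 1 - k \<notin> set [0..<d]" "N - 1 - (N - 1 - k) = k" by auto
        with * have "of_bool (bit r k) = (of_bool (bit c k) :: nat)"
          unfolding qbit_conv_bit by metis
        then show ?thesis by (simp only: of_bool_eq_iff)
      qed
      then show "bit (take_bit (N - d) r) k = bit (take_bit (N - d) c) k"
        by (auto simp: bit_take_bit_iff)
    qed
  next
    assume *: "take_bit (N - d) r = take_bit (N - d) c"
    show "\<forall>q<N. q \<notin> set [0..<d] \<longrightarrow> qbit N r q = qbit N c q"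
    proof clarsimp
      fix q assume "q < N" "\<not> q < d"
      then have "N - 1 - q < N - d" by auto
      then show "qbit N r q = qbit N c q"
        using arg_cong [OF *, of "\<lambda>z. bit z (N - 1 - q)"]
        by (simp add: bit_take_bit_iff qbit_conv_bit)
    qed
  qed
  moreover have "r < 2 ^ d * 2 ^ (N - d)" "c < 2 ^ d * 2 ^ (N - d)" using rc D by simp_all
  ultimately show "place N [0..<d] V $$ (r, c) = (V \<otimes>\<^sub>m 1\<^sub>m (2 ^ (N - d))) $$ (r, c)"
    using rc assms by (simp add: place_def tensor_mat_def subindex_prefix take_bit_eq_mod)
qed (use assms in \<open>simp_all add: place_def tensor_mat_def flip: power_add\<close>)


section \<open>Operators that are the identity on the first basis states\<close>

text \<open>For a square \<open>M\<close> of size at least \<open>k\<close>, this is the block form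
  \<open>diag(1, M')\<close> with a leading identity block of size \<open>k\<close>.\<close>

definition identity_below :: "nat \<Rightarrow> complex mat \<Rightarrow> bool" where
  "identity_below k M \<longleftrightarrow>
     (\<forall>i<dim_row M. \<forall>j<dim_col M. i < k \<or> j < k \<longrightarrow> M $$ (i, j) = of_bool (i = j))"

lemma identity_below_one [simp]: "identity_below k (1\<^sub>m m)"
  by (simp add: identity_below_def)

lemma identity_below_adjoint: "identity_below k M \<Longrightarrow> identity_below k (mat_adjoint M)"
  by (auto simp: identity_below_def)

text \<open>A row index below \<open>k\<close> is treated through \<open>A\<close>, a column index
  below \<open>k\<close> through \<open>B\<close>. Either way the sum collapses to a single entry of
  the other factor, whose row or column again has an index below \<open>k\<close>.\<close>

lemma identity_below_mult:
  assumes A: "A \<in> carrier_mat m m" "identity_below k A"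
    and B: "B \<in> carrier_mat m m" "identity_below k B"
  shows "identity_below k (A * B)"
  unfolding identity_below_def
proof (intro allI impI)
  fix i j assume "i < dim_row (A * B)" "j < dim_col (A * B)" and k: "i < k \<or> j < k"
  then have i: "i < m" and j: "j < m" using A B by simp_all
  have eq: "(A * B) $$ (i, j) = (\<Sum>x<m. A $$ (i, x) * B $$ (x, j))"
    using A(1) B(1) i j by (simp add: scalar_prod_def atLeast0LessThan)
  show "(A * B) $$ (i, j) = of_bool (i = j)"
  proof (cases "i < k")
    case True
    then have "(A * B) $$ (i, j) = (\<Sum>x<m. if x = i then B $$ (x, j) else 0)"
      unfolding eq using A i by (auto simp: identity_below_def intro!: sum.cong)
    also have "\<dots> = B $$ (i, j)" using i by simp
    finally show ?thesis using True B i j by (simp add: identity_below_def)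
  next
    case False
    then have "(A * B) $$ (i, j) = (\<Sum>x<m. if x = j then A $$ (i, x) else 0)"
      unfolding eq using B j k by (auto simp: identity_below_def intro!: sum.cong)
    also have "\<dots> = A $$ (i, j)" using j by simp
    finally show ?thesis using False k A i j by (simp add: identity_below_def)
  qed
qed

lemma mprod_carrier:
  "(\<And>M. M \<in> set Ms \<Longrightarrow> M \<in> carrier_mat (2 ^ m) (2 ^ m)) \<Longrightarrow> mprod m Ms \<in> carrier_mat (2 ^ m) (2 ^ m)"
  by (induction Ms) (auto simp: mprod_def intro!: mult_carrier_mat)

lemma identity_below_mprod:
  assumes "\<And>M. M \<in> set Ms \<Longrightarrow> M \<in> carrier_mat (2 ^ m) (2 ^ m)"
    and "\<And>M. M \<in> set Ms \<Longrightarrow> identity_below k M"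
  shows "identity_below k (mprod m Ms)"
  using assms
proof (induction Ms)
  case (Cons M Ms)
  have "mprod m (M # Ms) = M * mprod m Ms" by (simp add: mprod_def)
  with Cons show ?case
    using identity_below_mult [of M "2 ^ m" k "mprod m Ms"] mprod_carrier [of Ms m] by simp
qed (simp add: mprod_def)

text \<open>An index below \<open>k\<close> has quotient \<open>0\<close> and itself as remainder,
  since \<open>k\<close> does not exceed the size of \<open>B\<close>. Hence the leading row and
  column of \<open>A\<close> suffice.\<close>

lemma identity_below_tensor_mat:
  assumes A: "identity_below 1 A" and B: "identity_below k B"
    and k: "k \<le> dim_row B" "k \<le> dim_col B"
  shows "identity_below k (A \<otimes>\<^sub>m B)"
  unfolding identity_below_def
proof (intro allI impI)
  fix i j assume i: "i < dim_row (A \<otimes>\<^sub>m B)" and j: "j < dim_col (A \<otimes>\<^sub>m B)" and ij: "i < k \<or> j < k"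
  have "i < dim_row A * dim_row B" "j < dim_col A * dim_col B"
    using i j by (simp_all add: tensor_mat_def)
  moreover from this have "dim_row B > 0" "dim_col B > 0" "dim_row A > 0" "dim_col A > 0"
    by (auto intro: Nat.gr0I)
  ultimately have dims: "i mod dim_row B < dim_row B" "j mod dim_col B < dim_col B"
    "i div dim_row B < dim_row A" "j div dim_col B < dim_col A" "0 < dim_row A" "0 < dim_col A"
    by (simp_all add: less_mult_imp_div_less)
  have eq: "(A \<otimes>\<^sub>m B) $$ (i, j) = A $$ (i div dim_row B, j div dim_col B) *
      B $$ (i mod dim_row B, j mod dim_col B)"
    using i j by (simp add: tensor_mat_def)
  show "(A \<otimes>\<^sub>m B) $$ (i, j) = of_bool (i = j)"
  proof (cases "i < k")
    case True
    then have "i div dim_row B = 0" "i mod dim_row B = i" using k by simp_all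
    then have "(A \<otimes>\<^sub>m B) $$ (i, j) = of_bool (j div dim_col B = 0 \<and> i = j mod dim_col B)"
      unfolding eq using A B dims True by (auto simp: identity_below_def)
    also have "j div dim_col B = 0 \<and> i = j mod dim_col B \<longleftrightarrow> i = j"
      using True k by (metis div_less div_mult_mod_eq less_le_trans mod_less mult_0 add_0)
    finally show ?thesis .
  next
    case False
    with ij have "j < k" by simp
    then have "j div dim_col B = 0" "j mod dim_col B = j" using k by simp_all
    then have "(A \<otimes>\<^sub>m B) $$ (i, j) = of_bool (i div dim_row B = 0 \<and> i mod dim_row B = j)"
      unfolding eq using A B dims \<open>j < k\<close> by (auto simp: identity_below_def)
    also have "i div dim_row B = 0 \<and> i mod dim_row B = j \<longleftrightarrow> i = j"
      using \<open>j < k\<close> k by (metis div_less div_mult_mod_eq less_le_trans mod_less mult_0 add_0)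
    finally show ?thesis .
  qed
qed

text \<open>The size is carried through the induction because
  \<open>identity_below_tensor_mat\<close> asks the tail to have at least one row and one
  column.\<close>

lemma identity_below_tensor_mats:
  assumes "\<And>M. M \<in> set Ms \<Longrightarrow> identity_below 1 M" "\<And>M. M \<in> set Ms \<Longrightarrow> M \<in> carrier_mat 2 2"
  shows "identity_below 1 (tensor_mats Ms) \<and>
    tensor_mats Ms \<in> carrier_mat (2 ^ length Ms) (2 ^ length Ms)"
  using assms
proof (induction Ms)
  case (Cons M Ms)
  then have IH: "identity_below 1 (tensor_mats Ms)"
    "tensor_mats Ms \<in> carrier_mat (2 ^ length Ms) (2 ^ length Ms)" and M: "identity_below 1 M"
    "M \<in> carrier_mat 2 2" by auto
  have "tensor_mats (M # Ms) = M \<otimes>\<^sub>m tensor_mats Ms" by (simp add: tensor_mats_def)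
  then show ?case
    using identity_below_tensor_mat [OF M(1) IH(1)] IH(2) tensor_mat_carrier [OF M(2) IH(2)]
    by simp
qed (simp add: tensor_mats_def)

text \<open>The threshold \<open>l\<close> lives in the register of the gate: \<open>1\<close> for
  gates on ancillas only, \<open>2 ^ n\<close> for \<open>SELECT\<close>. A nonzero entry needs
  agreement on the untouched qubits by definition of \<open>place\<close>, and on the touched ones
  by \<open>subindex_eq_iff\<close>, so both indices coincide.\<close>

lemma identity_below_place:
  assumes V: "V \<in> carrier_mat (2 ^ length qs) (2 ^ length qs)" "identity_below l V"
    and sub: "\<And>x. x < k \<Longrightarrow> subindex N qs x < l"
  shows "identity_below k (place N qs V)"
  unfolding identity_below_def
proof (intro allI impI)
  fix i j assume "i < dim_row (place N qs V)" "j < dim_col (place N qs V)" and k: "i < k \<or> j < k"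
  then have i: "i < 2 ^ N" and j: "j < 2 ^ N" by (simp_all add: place_def)
  have "V $$ (subindex N qs i, subindex N qs j) = of_bool (subindex N qs i = subindex N qs j)"
  proof -
    have "subindex N qs i < l \<or> subindex N qs j < l" using sub k by blast
    moreover have "subindex N qs i < dim_row V" "subindex N qs j < dim_col V"
      using V(1) subindex_less by auto
    ultimately show ?thesis using V(2) unfolding identity_below_def by blast
  qed
  then show "place N qs V $$ (i, j) = of_bool (i = j)"
    using i j qbit_eqI [OF i j] by (auto simp: place_def subindex_eq_iff)
qed

text \<open>Columns below \<open>k\<close> are unit vectors, and the remaining columns meet zero
  entries of \<open>v\<close>.\<close>

lemma identity_below_mult_vec:
  assumes M: "M \<in> carrier_mat m m" "identity_below k M"
    and v: "v \<in> carrier_vec m" "\<And>i. k \<le> i \<Longrightarrow> i < m \<Longrightarrow> v $ i = 0"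
  shows "M *\<^sub>v v = v"
proof (rule eq_vecI)
  fix i assume "i < dim_vec v"
  then have i: "i < m" using v by simp
  have "(M *\<^sub>v v) $ i = (\<Sum>x<m. M $$ (i, x) * v $ x)"
    using M(1) v(1) i by (simp add: scalar_prod_def atLeast0LessThan)
  also have "\<dots> = (\<Sum>x<m. if x = i then v $ x else 0)"
  proof (rule sum.cong [OF refl])
    fix x assume "x \<in> {..<m}"
    then show "M $$ (i, x) * v $ x = (if x = i then v $ x else 0)"
      using M v(2) [of x] i by (cases "x < k") (auto simp: identity_below_def)
  qed
  also have "\<dots> = v $ i" using i by simp
  finally show "(M *\<^sub>v v) $ i = v $ i" .
qed (use M v in auto)

text \<open>Fixing the zero ket determines only the first column. By unitarity the adjoint fixes
  that ket too, and its first column is the conjugated first row. This serves the uncontrolled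
  \<open>VR\<close> and \<open>VL\<close> of the simplified circuit.\<close>

lemma identity_below_unitary:
  assumes V: "is_unitary m V" and ket: "V *\<^sub>v ket m 0 = ket m 0"
  shows "identity_below 1 V"
proof -
  have car: "V \<in> carrier_mat (2 ^ m) (2 ^ m)" and inv: "mat_adjoint V * V = 1\<^sub>m (2 ^ m)"
    using V by (auto simp: is_unitary_def)
  have e: "ket m 0 = unit_vec (2 ^ m) 0" by (simp add: ket_eq_unit_vec)
  have column: "M $$ (i, 0) = of_bool (i = 0)"
    if "M \<in> carrier_mat (2 ^ m) (2 ^ m)" "M *\<^sub>v ket m 0 = ket m 0" "i < 2 ^ m" for M i
  proof -
    have "M $$ (i, 0) = (M *\<^sub>v ket m 0) $ i"
      using that(1,3) by (simp add: e)
    also have "\<dots> = of_bool (i = 0)" unfolding that(2) using that(3) by (simp add: e)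
    finally show ?thesis .
  qed
  have "mat_adjoint V *\<^sub>v ket m 0 = mat_adjoint V *\<^sub>v (V *\<^sub>v ket m 0)" by (simp add: ket)
  also have "\<dots> = (mat_adjoint V * V) *\<^sub>v ket m 0"
    by (rule assoc_mult_mat_vec [symmetric, OF mat_adjoint_carrier [OF car] car]) (simp add: e)
  also have "\<dots> = ket m 0" by (simp add: inv e)
  finally have adj: "mat_adjoint V *\<^sub>v ket m 0 = ket m 0" .
  have "V $$ (0, j) = of_bool (0 = j)" if "j < 2 ^ m" for j
  proof -
    have "cnj (V $$ (0, j)) = of_bool (j = 0)"
      using column [OF mat_adjoint_carrier [OF car] adj that] car that by simp
    then show ?thesis by (metis complex_cnj_cnj complex_cnj_one complex_cnj_zero of_bool_def)
  qed
  then show ?thesis using column [OF car ket] car by (auto simp: identity_below_def)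
qed


section \<open>Controlled operators\<close>

text \<open>Brings operators with a leading qubit into the block form in which they act on
  concatenated vectors.\<close>

lemma tensor_mat_four_block:
  assumes A: "A \<in> carrier_mat 2 2" and B: "B \<in> carrier_mat m m"
  shows "A \<otimes>\<^sub>m B = four_block_mat (A $$ (0, 0) \<cdot>\<^sub>m B) (A $$ (0, 1) \<cdot>\<^sub>m B)
    (A $$ (1, 0) \<cdot>\<^sub>m B) (A $$ (1, 1) \<cdot>\<^sub>m B)"
proof (rule eq_matI)
  have blocks: "x div m = (if x < m then 0 else 1)" "x mod m = (if x < m then x else x - m)"
    if "x < m + m" for x
    using that by (auto simp: le_div_geq le_mod_geq)
  fix i j
  let ?F = "four_block_mat (A $$ (0, 0) \<cdot>\<^sub>m B) (A $$ (0, 1) \<cdot>\<^sub>m B)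
    (A $$ (1, 0) \<cdot>\<^sub>m B) (A $$ (1, 1) \<cdot>\<^sub>m B)"
  assume "i < dim_row ?F" "j < dim_col ?F"
  then have "i < m + m" "j < m + m" using B by simp_all
  then show "(A \<otimes>\<^sub>m B) $$ (i, j) = ?F $$ (i, j)"
    using A B by (auto simp: tensor_mat_def blocks)
qed (use A B in \<open>simp_all add: tensor_mat_def\<close>)

lemma ctrl_four_block:
  assumes "V \<in> carrier_mat m m"
  shows "ctrl V = four_block_mat (1\<^sub>m m) (0\<^sub>m m m) (0\<^sub>m m m) V"
proof -
  have "mat_of_rows_list 2 [[1, 0], [0, 0]] \<in> carrier_mat 2 (2 :: nat)"
    "mat_of_rows_list 2 [[0, 0], [0, 1]] \<in> carrier_mat 2 (2 :: nat)"
    by (auto simp: mat_of_rows_list_def)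
  note * = this [THEN tensor_mat_four_block]
  show ?thesis
    unfolding ctrl_def *(1) [OF one_carrier_mat] *(2) [OF assms] using assms
    by (intro eq_matI) (auto simp: *(1) [OF one_carrier_mat] mat_of_rows_list_def)
qed

lemma ctrl_carrier: "V \<in> carrier_mat m m \<Longrightarrow> ctrl V \<in> carrier_mat (2 * m) (2 * m)"
  by (auto simp: ctrl_four_block)

text \<open>Indices below \<open>m\<close> are those with control bit \<open>0\<close>, where
  \<open>ctrl V\<close> acts as the identity whatever \<open>V\<close> is.\<close>

lemma identity_below_ctrl: "V \<in> carrier_mat m m \<Longrightarrow> k \<le> m \<Longrightarrow> identity_below k (ctrl V)"
  by (auto simp: ctrl_four_block identity_below_def)

text \<open>The two halves are the branches of the control qubit; the next two lemmas let operators
  act on them branch by branch.\<close>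

lemma tensor_vec_append:
  assumes "u \<in> carrier_vec 2" "v \<in> carrier_vec m"
  shows "u \<otimes>\<^sub>v v = (u $ 0 \<cdot>\<^sub>v v) @\<^sub>v (u $ 1 \<cdot>\<^sub>v v)"
  using assms by (intro eq_vecI) (auto simp: tensor_vec_def le_div_geq le_mod_geq)

lemma ctrl_mult_append:
  assumes "V \<in> carrier_mat m m" "u \<in> carrier_vec m" "v \<in> carrier_vec m"
  shows "ctrl V *\<^sub>v (u @\<^sub>v v) = u @\<^sub>v (V *\<^sub>v v)"
  using assms by (simp add: ctrl_four_block mult_mat_vec_split [of _ m _ m])

lemma one_tensor_mult_append:
  assumes "V \<in> carrier_mat m m" "u \<in> carrier_vec m" "v \<in> carrier_vec m"
  shows "(1\<^sub>m 2 \<otimes>\<^sub>m V) *\<^sub>v (u @\<^sub>v v) = (V *\<^sub>v u) @\<^sub>v (V *\<^sub>v v)"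
proof -
  have "1\<^sub>m 2 \<otimes>\<^sub>m V = four_block_mat V (0\<^sub>m m m) (0\<^sub>m m m) V"
    using assms(1) by (subst tensor_mat_four_block [of _ V m]) (auto intro!: eq_matI)
  with assms show ?thesis by (simp add: mult_mat_vec_split [of _ m _ m])
qed


section \<open>The gates of the circuits\<close>

lemma Ry_carrier [simp]: "Ry t \<in> carrier_mat 2 2"
  by (intro carrier_matI) (simp_all add: Ry_def mat_of_rows_list_def)

lemma mat_adjoint_Ry: "mat_adjoint (Ry t) = Ry (- t)"
proof (rule eq_matI)
  fix i j assume "i < dim_row (Ry (- t))" "j < dim_col (Ry (- t))"
  then have "i < 2" "j < 2" by (simp_all add: Ry_def mat_of_rows_list_def)
  then show "mat_adjoint (Ry t) $$ (i, j) = Ry (- t) $$ (i, j)"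
    by (auto simp: Ry_def mat_of_rows_list_def less_2_cases_iff)
qed (simp_all add: Ry_def mat_of_rows_list_def)

lemma CRY_carrier [simp]: "CRY a N d \<in> carrier_mat (2 ^ d) (2 ^ d)"
  unfolding CRY_def by (rule mprod_carrier) auto

text \<open>Every gate of the ladder is controlled, so none fires on the all-zero string, for any
  angles.\<close>

lemma identity_below_CRY: "identity_below 1 (CRY a N d)"
  unfolding CRY_def
proof (rule identity_below_mprod)
  fix M assume "M \<in> set (rev (map (\<lambda>k. place d [k - 1, k] (ctrl (Ry (theta a N d k)))) [1..<d]))"
  then obtain k where M: "M = place d [k - 1, k] (ctrl (Ry (theta a N d k)))" by auto
  show "identity_below 1 M"
    unfolding M using ctrl_carrier [OF Ry_carrier]
    by (intro identity_below_place [where l = 1] identity_below_ctrl [OF Ry_carrier]) simp_all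
qed auto

text \<open>Each phase gate is diagonal with entry \<open>1\<close> at the zero ket.\<close>

lemma identity_below_phase_layer: "identity_below 1 (phase_layer z0 a d)"
  and phase_layer_carrier: "phase_layer z0 a d \<in> carrier_mat (2 ^ d) (2 ^ d)"
proof -
  have "identity_below 1 (phase_gate t)" "phase_gate t \<in> carrier_mat 2 2" for t
    by (auto simp: identity_below_def phase_gate_def mat_of_rows_list_def less_2_cases_iff)
  then show "identity_below 1 (phase_layer z0 a d)"
    "phase_layer z0 a d \<in> carrier_mat (2 ^ d) (2 ^ d)"
    using identity_below_tensor_mats [of "map (\<lambda>k. phase_gate (phase z0 a k)) [0..<d]"]
    by (auto simp: phase_layer_def)
qed

lemma pauli_string_0_0: "pauli_string n 0 0 = 1\<^sub>m (2 ^ n)"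
proof -
  have "pauli_Z \<in> carrier_mat 2 2" "pauli_X \<in> carrier_mat 2 2"
    by (auto simp: pauli_Z_def pauli_X_def mat_of_rows_list_def)
  then have "pauli_Z ^\<^sub>m 0 * pauli_X ^\<^sub>m 0 = 1\<^sub>m 2" by simp
  moreover have "tensor_mats (map (\<lambda>_. 1\<^sub>m 2) ls) = 1\<^sub>m (2 ^ length ls)" for ls :: "nat list"
    by (induction ls) (simp_all add: tensor_mats_def)
  from this [of "[0..<n]"] have "tensor_mats (map (\<lambda>_. 1\<^sub>m 2) [0..<n]) = 1\<^sub>m (2 ^ n)" by simp
  ultimately show ?thesis by (simp add: pauli_string_def qbit_def)
qed

lemma SELECT_carrier: "SELECT n \<in> carrier_mat (2 ^ (3 * n)) (2 ^ (3 * n))"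
  by (simp add: SELECT_def)

text \<open>Indices below \<open>2 ^ n\<close> make up block \<open>0\<close>, which holds the empty
  Pauli string. An index outside this block gives a vanishing entry by block diagonality.\<close>

lemma identity_below_SELECT: "identity_below (2 ^ n) (SELECT n)"
  unfolding identity_below_def
proof (intro allI impI)
  fix i j assume "i < dim_row (SELECT n)" "j < dim_col (SELECT n)"
    and k: "i < 2 ^ n \<or> j < 2 ^ n"
  then have ij: "i < 2 ^ (3 * n)" "j < 2 ^ (3 * n)" by (simp_all add: SELECT_def)
  show "SELECT n $$ (i, j) = of_bool (i = j)"
  proof (cases "i div 2 ^ n = j div 2 ^ n")
    case True
    with k have "i < 2 ^ n" "j < 2 ^ n"
      by (metis div_eq_0_iff power_not_zero zero_neq_numeral)+
    then show ?thesis using ij by (simp add: SELECT_def pauli_string_0_0)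
  next
    case False
    then have "i \<noteq> j" by blast
    with False show ?thesis using ij by (simp add: SELECT_def)
  qed
qed

section \<open>Reading the registers when all ancillas are zero\<close>

lemma qbit_leading:
  assumes "q < d + 2 * n * d" "x < 2 ^ n"
  shows "qbit (qubits n d) x q = 0"
proof -
  \<comment> \<open>There are \<open>d + 2 * n * d + n\<close> qubits, so every ancilla lies at bit
    position \<open>n\<close> or higher.\<close>
  have "n \<le> qubits n d - 1 - q" using assms(1) by (simp add: qubits_def algebra_simps)
  then have "x < 2 ^ (qubits n d - 1 - q)"
    using assms(2) by (meson le_less_trans less_le_trans power_increasing one_le_numeral)
  then show ?thesis by (simp add: qbit_def)
qed

lemma subindex_leading:
  assumes "\<And>q. q \<in> set qs \<Longrightarrow> q < d + 2 * n * d" "x < 2 ^ n"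
  shows "subindex (qubits n d) qs x = 0"
  using assms qbit_leading by (simp add: subindex_eq_0_iff)

lemma
  assumes "s \<in> {1..d}"
  shows inner_reg_less: "q \<in> set (inner_reg n d s) \<Longrightarrow> q < d + 2 * n * d"
    and length_inner_reg: "length (inner_reg n d s) = 2 * n"
proof -
  have "2 * n * s \<le> 2 * n * d" using assms by simp
  then show "q \<in> set (inner_reg n d s) \<Longrightarrow> q < d + 2 * n * d"
    unfolding inner_reg_def set_upt by (metis add_le_cancel_left atLeastLessThan_iff less_le_trans)
  \<comment> \<open>As \<open>s\<close> is at least \<open>1\<close>, the truncated
    \<open>s - 1\<close> is a true predecessor and the bounds of the register differ by
    \<open>2 * n\<close>.\<close>
  have "2 * n * s = 2 * n * (s - 1) + 2 * n" using assms by (cases s) auto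
  then show "length (inner_reg n d s) = 2 * n" by (simp add: inner_reg_def)
qed

lemma identity_below_on_outer:
  assumes "V \<in> carrier_mat (2 ^ d) (2 ^ d)" "identity_below 1 V"
  shows "identity_below (2 ^ n) (on_outer n d V)"
  unfolding on_outer_def
  using assms subindex_leading [of "[0..<d]" d n]
  by (intro identity_below_place [where l = 1]) auto

lemma identity_below_on_inner:
  assumes "s \<in> {1..d}" "V \<in> carrier_mat (2 ^ (2 * n)) (2 ^ (2 * n))" "identity_below 1 V"
  shows "identity_below (2 ^ n) (on_inner n d s V)"
  unfolding on_inner_def
  using assms subindex_leading [OF inner_reg_less [OF assms(1)]]
  by (intro identity_below_place [where l = 1]) (auto simp: length_inner_reg)

text \<open>The control takes over the role that \<open>identity_below 1 V\<close> has in
  \<open>identity_below_on_inner\<close>: it is an outer ancilla and reads \<open>0\<close>.\<close>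

lemma identity_below_ctrl_inner:
  assumes "s \<in> {1..d}" "V \<in> carrier_mat (2 ^ (2 * n)) (2 ^ (2 * n))"
  shows "identity_below (2 ^ n) (ctrl_inner n d s V)"
  unfolding ctrl_inner_def
proof (rule identity_below_place [where l = 1])
  show "ctrl V \<in> carrier_mat (2 ^ length ((s - 1) # inner_reg n d s))
      (2 ^ length ((s - 1) # inner_reg n d s))"
    using ctrl_carrier [OF assms(2)] by (simp add: length_inner_reg [OF assms(1)])
  show "identity_below 1 (ctrl V)" using identity_below_ctrl [OF assms(2)] by simp
  fix x :: nat assume "x < 2 ^ n"
  moreover have "q < d + 2 * n * d" if "q \<in> set ((s - 1) # inner_reg n d s)" for q
    using that inner_reg_less [OF assms(1)] assms(1) by auto
  ultimately show "subindex (qubits n d) ((s - 1) # inner_reg n d s) x < 1"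
    by (simp only: subindex_leading)
qed

text \<open>The inner register contributes \<open>0\<close> to the subindex, while the system
  register ranges freely below \<open>2 ^ n\<close>; hence the larger threshold.\<close>

lemma identity_below_select_at:
  assumes "s \<in> {1..d}"
  shows "identity_below (2 ^ n) (select_at n d s)"
  unfolding select_at_def
proof (rule identity_below_place [where l = "2 ^ n"])
  have sys: "length (system_reg n d) = n" by (simp add: system_reg_def qubits_def algebra_simps)
  then show "SELECT n \<in> carrier_mat (2 ^ length (inner_reg n d s @ system_reg n d))
      (2 ^ length (inner_reg n d s @ system_reg n d))"
    using SELECT_carrier [of n] by (simp add: length_inner_reg [OF assms])
  show "identity_below (2 ^ n) (SELECT n)" by (rule identity_below_SELECT)
  fix x :: nat assume "x < 2 ^ n"
  then show "subindex (qubits n d) (inner_reg n d s @ system_reg n d) x < 2 ^ n"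
    using subindex_leading [OF inner_reg_less [OF assms]] subindex_less [of _ "system_reg n d"] sys
    by (simp add: subindex_append)
qed

section \<open>The two cores and \<open>W'\<close> as products of such gates\<close>

lemma gate_carriers [simp]:
  "on_outer n d V \<in> carrier_mat (2 ^ qubits n d) (2 ^ qubits n d)"
  "on_inner n d s V \<in> carrier_mat (2 ^ qubits n d) (2 ^ qubits n d)"
  "ctrl_inner n d s V \<in> carrier_mat (2 ^ qubits n d) (2 ^ qubits n d)"
  "select_at n d s \<in> carrier_mat (2 ^ qubits n d) (2 ^ qubits n d)"
  by (simp_all add: on_outer_def on_inner_def ctrl_inner_def select_at_def)

lemma general_core_carrier:
  "general_core n d PR PL \<in> carrier_mat (2 ^ qubits n d) (2 ^ qubits n d)"
  unfolding general_core_def by (intro mult_carrier_mat [where n = "2 ^ qubits n d"] mprod_carrier)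
    (auto simp del: upt_Suc)

lemma simplified_core_carrier:
  "simplified_core n d VR AR VL AL \<in> carrier_mat (2 ^ qubits n d) (2 ^ qubits n d)"
  unfolding simplified_core_def by (intro mult_carrier_mat [where n = "2 ^ qubits n d"] mprod_carrier)
    (auto simp del: upt_Suc)

lemma identity_below_general_core:
  assumes "PR \<in> carrier_mat (2 ^ (2 * n)) (2 ^ (2 * n))"
    and "PL \<in> carrier_mat (2 ^ (2 * n)) (2 ^ (2 * n))"
  shows "identity_below (2 ^ n) (general_core n d PR PL)"
  unfolding general_core_def
  by (intro identity_below_mult [where m = "2 ^ qubits n d"]
      mult_carrier_mat [where n = "2 ^ qubits n d"] mprod_carrier identity_below_mprod)
    (use assms in \<open>auto simp del: upt_Suc intro!: identity_below_ctrl_inner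
      identity_below_select_at mat_adjoint_carrier\<close>)

text \<open>\<open>VR\<close> and \<open>VL\<close> act uncontrolled and must fix the zero ket
  themselves; \<open>AR\<close> and \<open>AL\<close> are guarded by their control qubits.\<close>

lemma identity_below_simplified_core:
  assumes "AR \<in> carrier_mat (2 ^ (2 * n)) (2 ^ (2 * n))"
    and "AL \<in> carrier_mat (2 ^ (2 * n)) (2 ^ (2 * n))"
    and "VR \<in> carrier_mat (2 ^ (2 * n)) (2 ^ (2 * n))" "identity_below 1 VR"
    and "VL \<in> carrier_mat (2 ^ (2 * n)) (2 ^ (2 * n))" "identity_below 1 VL"
  shows "identity_below (2 ^ n) (simplified_core n d VR AR VL AL)"
  unfolding simplified_core_def
  by (intro identity_below_mult [where m = "2 ^ qubits n d"]
      mult_carrier_mat [where n = "2 ^ qubits n d"] mprod_carrier identity_below_mprod)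
    (use assms in \<open>auto simp del: upt_Suc intro!: identity_below_ctrl_inner identity_below_on_inner
      identity_below_select_at mat_adjoint_carrier identity_below_adjoint\<close>)

lemma circuit_W'_carrier:
  assumes "core \<in> carrier_mat (2 ^ qubits n d) (2 ^ qubits n d)"
  shows "circuit_W' z0 n a N d core \<in> carrier_mat (2 ^ qubits n d) (2 ^ qubits n d)"
  unfolding circuit_W'_def using assms by (intro mult_carrier_mat) auto

lemma identity_below_circuit_W':
  assumes "core \<in> carrier_mat (2 ^ qubits n d) (2 ^ qubits n d)" "identity_below (2 ^ n) core"
  shows "identity_below (2 ^ n) (circuit_W' z0 n a N d core)"
  unfolding circuit_W'_def
  by (intro identity_below_mult [where m = "2 ^ qubits n d"]
      mult_carrier_mat [where n = "2 ^ qubits n d"] identity_below_on_outer gate_carriers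
      identity_below_adjoint identity_below_CRY mat_adjoint_carrier CRY_carrier assms
      identity_below_mult [where m = "2 ^ d" and k = 1] mult_carrier_mat [where n = "2 ^ d"]
      identity_below_phase_layer phase_layer_carrier)

section \<open>Splitting the first rotation off \<open>W\<close>\<close>

lemma le_qubits: "d \<le> qubits n d"
  by (simp add: qubits_def)

lemma on_outer_mult:
  assumes "A \<in> carrier_mat (2 ^ d) (2 ^ d)" "B \<in> carrier_mat (2 ^ d) (2 ^ d)"
  shows "on_outer n d (A * B) = on_outer n d A * on_outer n d B"
  using assms mult_carrier_mat [OF assms] le_qubits
  by (simp add: on_outer_def place_prefix tensor_mat_mult_one)

lemma place_first:
  assumes "1 \<le> N" "V \<in> carrier_mat 2 2"
  shows "place N [0] V = V \<otimes>\<^sub>m 1\<^sub>m (2 ^ (N - 1))"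
  using place_prefix [of 1 N V] assms by simp

text \<open>Padding from one qubit to \<open>d\<close> and then to the whole circuit is the same as
  padding once.\<close>

lemma on_outer_first:
  assumes "1 \<le> d" "V \<in> carrier_mat 2 2"
  shows "on_outer n d (place d [0] V) = place (qubits n d) [0] V"
proof -
  have "(2::nat) ^ (d - 1) * 2 ^ (qubits n d - d) = 2 ^ (qubits n d - 1)"
    using assms(1) le_qubits [of d n] by (simp flip: power_add)
  moreover have "on_outer n d (place d [0] V) = place d [0] V \<otimes>\<^sub>m 1\<^sub>m (2 ^ (qubits n d - d))"
    unfolding on_outer_def by (rule place_prefix [OF le_qubits]) simp
  ultimately show ?thesis
    using assms le_qubits [of d n] by (simp add: place_first tensor_mat_one_one)
qed

text \<open>The adjoint of \<open>POLY_L\<close> reverses its order, which puts the inverse rotation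
  leftmost in \<open>W\<close>; the rotation of \<open>POLY_R\<close> is rightmost already.\<close>

lemma circuit_W_factor:
  assumes d: "1 \<le> d" and core: "core \<in> carrier_mat (2 ^ qubits n d) (2 ^ qubits n d)"
  shows "circuit_W z0 n a N d core =
    place (qubits n d) [0] (Ry (- theta a N d 0)) * circuit_W' z0 n a N d core
      * place (qubits n d) [0] (Ry (theta a N d 0))"
proof -
  let ?D = "2 ^ qubits n d :: nat"
  let ?R = "place d [0] (Ry (theta a N d 0))"
  have R: "?R \<in> carrier_mat (2 ^ d) (2 ^ d)" by simp
  have adjR: "mat_adjoint ?R = place d [0] (Ry (- theta a N d 0))"
    using d by (simp add: place_first mat_adjoint_tensor_mat mat_adjoint_Ry)
  have "on_outer n d (mat_adjoint (POLY_L a N d))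
      = on_outer n d (mat_adjoint ?R) * on_outer n d (mat_adjoint (CRY a N d))"
    unfolding POLY_L_def mat_adjoint_mult [OF CRY_carrier R]
    by (rule on_outer_mult) (simp_all add: mat_adjoint_carrier)
  then have L: "on_outer n d (mat_adjoint (POLY_L a N d))
      = place (qubits n d) [0] (Ry (- theta a N d 0)) * on_outer n d (mat_adjoint (CRY a N d))"
    using d by (simp add: adjR on_outer_first)
  have "on_outer n d (POLY_R z0 a N d)
      = on_outer n d (phase_layer z0 a d * CRY a N d) * on_outer n d ?R"
    unfolding POLY_R_def
    by (rule on_outer_mult [OF mult_carrier_mat [OF phase_layer_carrier CRY_carrier] R])
  then have R': "on_outer n d (POLY_R z0 a N d)
      = on_outer n d (phase_layer z0 a d * CRY a N d)
        * place (qubits n d) [0] (Ry (theta a N d 0))"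
    using d by (simp add: on_outer_first)
  \<comment> \<open>Here \<open>x\<close> and \<open>y\<close> are the rotations, \<open>m\<close>
    is the core, and \<open>c\<close> and \<open>p\<close> are the remaining outer layers; the
    bracket on the right is \<open>W'\<close>.\<close>
  have assoc: "(x * c) * m * (p * y) = x * (c * m * p) * y"
    if "x \<in> carrier_mat ?D ?D" "c \<in> carrier_mat ?D ?D" "m \<in> carrier_mat ?D ?D"
      "p \<in> carrier_mat ?D ?D" "y \<in> carrier_mat ?D ?D" for x c m p y :: "complex mat"
    using that by (simp add: assoc_mult_mat [of _ ?D ?D _ ?D _ ?D] mult_carrier_mat [of _ ?D ?D _ ?D])
  show ?thesis
    unfolding circuit_W_def circuit_W'_def L R' by (rule assoc) (simp_all add: core)
qed

section \<open>The initial state is supported below \<open>2 ^ n\<close>\<close>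

lemma
  assumes "\<phi> \<in> carrier_vec (2 ^ n)"
  shows initial_state_carrier: "ket d 0 \<otimes>\<^sub>v ket (2 * d * n) 0 \<otimes>\<^sub>v \<phi> \<in> carrier_vec (2 ^ qubits n d)"
    and initial_state_eq_0: "2 ^ n \<le> i \<Longrightarrow> i < 2 ^ qubits n d \<Longrightarrow>
      (ket d 0 \<otimes>\<^sub>v ket (2 * d * n) 0 \<otimes>\<^sub>v \<phi>) $ i = 0"
proof -
  let ?m = "2 ^ (2 * d * n) :: nat"
  have D: "2 ^ d * (?m * 2 ^ n) = (2 ^ qubits n d :: nat)"
    by (simp add: qubits_def algebra_simps flip: power_add)
  have dim: "dim_vec \<phi> = 2 ^ n" using assms by simp
  show "ket d 0 \<otimes>\<^sub>v ket (2 * d * n) 0 \<otimes>\<^sub>v \<phi> \<in> carrier_vec (2 ^ qubits n d)"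
    using dim D by (intro carrier_vecI) (simp add: tensor_vec_def ket_mod)
  assume i: "2 ^ n \<le> i" "i < 2 ^ qubits n d"
  then have i': "i < 2 ^ d * (?m * 2 ^ n)" unfolding D by simp
  have "i div (?m * 2 ^ n) < 2 ^ d" using i' by (rule less_mult_imp_div_less)
  moreover have mod: "i mod (?m * 2 ^ n) < ?m * 2 ^ n" by simp
  moreover have "i mod (?m * 2 ^ n) div 2 ^ n < ?m" using mod by (rule less_mult_imp_div_less)
  \<comment> \<open>If the outer ancillas read \<open>0\<close>, then \<open>i\<close> is its own
    remainder, and \<open>2 ^ n \<le> i\<close> makes the inner reading nonzero. So one of the two
    kets always contributes a zero factor.\<close>
  moreover have "i mod (?m * 2 ^ n) div 2 ^ n \<noteq> 0" if "i div (?m * 2 ^ n) = 0"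
  proof -
    from that have "i < ?m * 2 ^ n" by (simp add: div_eq_0_iff)
    then have "i mod (?m * 2 ^ n) = i" by simp
    with i(1) show ?thesis by (simp add: div_eq_0_iff)
  qed
  ultimately show "(ket d 0 \<otimes>\<^sub>v ket (2 * d * n) 0 \<otimes>\<^sub>v \<phi>) $ i = 0"
    using i' by (auto simp: tensor_vec_def ket_mod dim)
qed

section \<open>Comparing the two branches of the control\<close>

theorem theorem4:
  fixes n d K :: nat
    and H PR PL core W W' :: "complex mat"
    and \<alpha> :: "nat \<Rightarrow> nat \<Rightarrow> complex"
    and a :: "nat \<Rightarrow> complex"
    and z0 N :: real
  assumes n: "n \<ge> 1" and d: "d \<ge> 1"
    and H: "H \<in> carrier_mat (2 ^ n) (2 ^ n)" "H \<noteq> 0\<^sub>m (2 ^ n) (2 ^ n)"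
    and decomposition: "H = pauli_sum n \<alpha>"
    and N: "N = one_norm n \<alpha>"
    and lead: "a d \<noteq> 0"
    and PR: "is_unitary (2 * n) PR" "PR *\<^sub>v ket (2 * n) 0 = prep_R z0 n \<alpha>"
    and PL: "is_unitary (2 * n) PL" "PL *\<^sub>v ket (2 * n) 0 = prep_L n \<alpha>"
    and core: "core = general_core n d PR PL \<or>
      (\<exists>VR AR VL AL.
         is_unitary (2 * n) VR \<and> is_unitary (2 * n) AR \<and>
         is_unitary (2 * n) VL \<and> is_unitary (2 * n) AL \<and>
         PR = VR * AR \<and> PL = VL * AL \<and>
         VR *\<^sub>v ket (2 * n) 0 = ket (2 * n) 0 \<and> VL *\<^sub>v ket (2 * n) 0 = ket (2 * n) 0 \<and>
         single_qubit_circuit K (2 * n) AR \<and> single_qubit_circuit K (2 * n) AL \<and>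
         core = simplified_core n d VR AR VL AL)"
    and W: "W = circuit_W z0 n a N d core"
    and W': "W' = circuit_W' z0 n a N d core"
  shows "W = place (qubits n d) [0] (Ry (- theta a N d 0)) * W'
               * place (qubits n d) [0] (Ry (theta a N d 0)) \<and>
    (\<forall>c0 c1 c \<phi>. c = c0 \<cdot>\<^sub>v ket 1 0 + c1 \<cdot>\<^sub>v ket 1 1 \<and> is_state 1 c \<and> is_state n \<phi> \<longrightarrow>
      postselect n d *\<^sub>v (ctrl W *\<^sub>v (c \<otimes>\<^sub>v ket d 0 \<otimes>\<^sub>v ket (2 * d * n) 0 \<otimes>\<^sub>v \<phi>))
    = postselect n d *\<^sub>v
        (ctrl (place (qubits n d) [0] (Ry (- theta a N d 0))) *\<^sub>v
        ((1\<^sub>m 2 \<otimes>\<^sub>m W') *\<^sub>v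
        (ctrl (place (qubits n d) [0] (Ry (theta a N d 0))) *\<^sub>v
         (c \<otimes>\<^sub>v ket d 0 \<otimes>\<^sub>v ket (2 * d * n) 0 \<otimes>\<^sub>v \<phi>)))))"
proof (intro conjI allI impI)
  let ?D = "2 ^ qubits n d :: nat"
  let ?R = "place (qubits n d) [0] (Ry (theta a N d 0))"
  let ?L = "place (qubits n d) [0] (Ry (- theta a N d 0))"
  have carrier: "core \<in> carrier_mat ?D ?D"
    using core general_core_carrier simplified_core_carrier by metis
  have id: "identity_below (2 ^ n) core"
    using core
  proof (elim disjE exE conjE)
    assume "core = general_core n d PR PL"
    then show ?thesis
      using PR(1) PL(1) identity_below_general_core by (simp add: is_unitary_def)
  next
    fix VR AR VL AL
    assume "core = simplified_core n d VR AR VL AL"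
      and V: "is_unitary (2 * n) VR" "VR *\<^sub>v ket (2 * n) 0 = ket (2 * n) 0"
        "is_unitary (2 * n) VL" "VL *\<^sub>v ket (2 * n) 0 = ket (2 * n) 0"
      and "is_unitary (2 * n) AR" "is_unitary (2 * n) AL"
    then show ?thesis
      using identity_below_simplified_core [of AR n AL VR VL d]
        identity_below_unitary [OF V(1,2)] identity_below_unitary [OF V(3,4)]
      by (simp add: is_unitary_def)
  qed
  have W'_carrier: "W' \<in> carrier_mat ?D ?D"
    unfolding W' by (rule circuit_W'_carrier [OF carrier])
  show factor: "W = ?L * W' * ?R"
    unfolding W W' by (rule circuit_W_factor [OF d carrier])
  fix c0 c1 c \<phi>
  assume "c = c0 \<cdot>\<^sub>v ket 1 0 + c1 \<cdot>\<^sub>v ket 1 1 \<and> is_state 1 c \<and> is_state n \<phi>"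
  then have c: "c \<in> carrier_vec 2" and phi: "\<phi> \<in> carrier_vec (2 ^ n)"
    unfolding is_state_def by (metis power_one_right)+
  define v where "v = ket d 0 \<otimes>\<^sub>v ket (2 * d * n) 0 \<otimes>\<^sub>v \<phi>"
  have v: "v \<in> carrier_vec ?D" unfolding v_def by (rule initial_state_carrier [OF phi])
  have W'_v: "W' *\<^sub>v v = v"
  proof (rule identity_below_mult_vec [OF W'_carrier _ v])
    show "identity_below (2 ^ n) W'"
      unfolding W' by (rule identity_below_circuit_W' [OF carrier id])
    show "v $ i = 0" if "2 ^ n \<le> i" "i < ?D" for i
      unfolding v_def using initial_state_eq_0 [OF phi that] .
  qed
  \<comment> \<open>The branches with control \<open>0\<close> and control \<open>1\<close>,
    weighted by the amplitudes of \<open>c\<close>.\<close>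
  let ?u = "c $ 0 \<cdot>\<^sub>v v" and ?w = "c $ 1 \<cdot>\<^sub>v v"
  have u: "?u \<in> carrier_vec ?D" and w: "?w \<in> carrier_vec ?D" using v by simp_all
  have R: "?R \<in> carrier_mat ?D ?D" and L: "?L \<in> carrier_mat ?D ?D" by simp_all
  note Rw = mult_mat_vec_carrier [OF R w]
  note W'Rw = mult_mat_vec_carrier [OF W'_carrier Rw]
  have W'_u: "W' *\<^sub>v ?u = ?u" using mult_mat_vec [OF W'_carrier v] W'_v by simp
  have "W \<in> carrier_mat ?D ?D"
    unfolding factor by (intro mult_carrier_mat [OF mult_carrier_mat [OF L W'_carrier] R])
  then have "ctrl W *\<^sub>v (c \<otimes>\<^sub>v v) = ?u @\<^sub>v (W *\<^sub>v ?w)"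
    using u w by (simp add: tensor_vec_append [OF c v] ctrl_mult_append)
  also have "W *\<^sub>v ?w = ?L *\<^sub>v (W' *\<^sub>v (?R *\<^sub>v ?w))"
    unfolding factor assoc_mult_mat_vec [OF mult_carrier_mat [OF L W'_carrier] R w]
    by (rule assoc_mult_mat_vec [OF L W'_carrier Rw])
  \<comment> \<open>In the \<open>0\<close> branch both controlled rotations idle and
    \<open>W'\<close> fixes \<open>?u\<close>; in the \<open>1\<close> branch the three operators
    compose to \<open>W\<close>.\<close>
  also have "?u @\<^sub>v \<dots> = ctrl ?L *\<^sub>v ((1\<^sub>m 2 \<otimes>\<^sub>m W') *\<^sub>v (ctrl ?R *\<^sub>v (c \<otimes>\<^sub>v v)))"
    unfolding tensor_vec_append [OF c v] ctrl_mult_append [OF R u w]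
      one_tensor_mult_append [OF W'_carrier u Rw] W'_u ctrl_mult_append [OF L u W'Rw] ..
  finally show "postselect n d *\<^sub>v (ctrl W *\<^sub>v (c \<otimes>\<^sub>v ket d 0 \<otimes>\<^sub>v ket (2 * d * n) 0 \<otimes>\<^sub>v \<phi>))
    = postselect n d *\<^sub>v (ctrl ?L *\<^sub>v ((1\<^sub>m 2 \<otimes>\<^sub>m W') *\<^sub>v
        (ctrl ?R *\<^sub>v (c \<otimes>\<^sub>v ket d 0 \<otimes>\<^sub>v ket (2 * d * n) 0 \<otimes>\<^sub>v \<phi>))))"
    \<comment> \<open>The states are already equal, so applying \<open>postselect\<close> preserves
      the equality.\<close>
    unfolding v_def by (rule arg_cong)
qed

end
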